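(* Let $(X,d,\mu)$ be a metric measure space with $\mu$ Ahlfors $Q$-regular and doubling. Let $p(\cdot)\in\mathcal{P}(X)$ and let $\varphi:X\to X$ be a non-singular Borel measurable map such that the composition operator $C_\varphi:f\mapsto f\circ\varphi$ is a non-trivial (i.e. non-zero) bounded operator on $L^{p(\cdot)}(X)$. Then $C_\varphi$ is not compact on $L^{p(\cdot)}(X)$.
   Context: $(X,d,\mu)$ is a metric space with a Borel regular measure $\mu$ such that every nonempty open set has positive measure and every bounded set has finite measure. $\mathcal{P}(X)$ is the set of Borel measurable functions $p:X\to[1,\infty)$. $L^{p(\cdot)}(X)$ is the set of measurable $f$ on $X$ such that $\rho(f/\eta)<\infty$ for some $\eta>0$, where $\rho(f)=\int_X|f(x)|^{p(x)}\,d\mu(x)$; it is a Banach space with norm $\|f\|_{p(\cdot)}=\inf\{\eta>0:\rho(f/\eta)\le1\}$. $\mu$ is Ahlfors $Q$-regular ($Q>0$) if there are positive constants $c,C$ with $c\,\mathrm{diam}(B)^Q\le\mu(B)\le C\,\mathrm{diam}(B)^Q$ for every ball $B\subset X$ with $\mathrm{diam}\,B\le2\,\mathrm{diam}\,X$; it is doubling if there is $C>0$ with $\mu(B(x,2r))\le C\mu(B(x,r))$ for every ball $B(x,r)$. $\varphi$ is non-singular if $\mu(\varphi^{-1}(E))=0$ for every Borel $E$ with $\mu(E)=0$. *)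

theory Defs
  imports "HOL-Analysis.Analysis"
begin

text \<open>
  The space \<open>X\<close> is the type \<open>'a\<close>. The sigma-algebra of \<open>M\<close> may be larger than the Borel one (for
  instance the Caratheodory-measurable sets of a Borel regular outer measure), but every measurable
  set has a Borel hull of the same measure. Since \<open>UNIV\<close> is a Borel set, \<open>space M = UNIV\<close>.
\<close>

locale metric_measure_space =
  fixes M :: "'a::metric_space measure"
  assumes borel_sets: "sets borel \<subseteq> sets M"
    and borel_hull: "A \<in> sets M \<Longrightarrow> \<exists>B\<in>sets borel. A \<subseteq> B \<and> emeasure M B = emeasure M A"
    and open_pos: "open U \<Longrightarrow> U \<noteq> {} \<Longrightarrow> emeasure M U > 0"
    and bounded_finite: "A \<in> sets M \<Longrightarrow> bounded A \<Longrightarrow> emeasure M A < \<infinity>"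

text \<open>
  \<^const>\<open>diameter\<close> is unspecified on unbounded sets. If \<open>X\<close> is unbounded then its diameter is
  infinite and the restriction on the balls is void, hence the guard \<open>bounded UNIV\<close>.
\<close>

definition ahlfors_regular :: "'a::metric_space measure \<Rightarrow> real \<Rightarrow> bool" where
  "ahlfors_regular M Q \<longleftrightarrow>
    (\<exists>c>0. \<exists>C>0. \<forall>x::'a. \<forall>r>0.
      (bounded (UNIV::'a set) \<longrightarrow> diameter (ball x r) \<le> 2 * diameter (UNIV::'a set)) \<longrightarrow>
      ennreal (c * diameter (ball x r) powr Q) \<le> emeasure M (ball x r) \<and>
      emeasure M (ball x r) \<le> ennreal (C * diameter (ball x r) powr Q))"

definition doubling :: "'a::metric_space measure \<Rightarrow> bool" where
  "doubling M \<longleftrightarrow>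
    (\<exists>C>0. \<forall>x. \<forall>r>0. emeasure M (ball x (2 * r)) \<le> ennreal C * emeasure M (ball x r))"

definition nonsingular :: "'a::metric_space measure \<Rightarrow> ('a \<Rightarrow> 'a) \<Rightarrow> bool" where
  "nonsingular M \<phi> \<longleftrightarrow> (\<forall>E\<in>sets borel. emeasure M E = 0 \<longrightarrow> emeasure M (\<phi> -` E) = 0)"

text \<open>
  The scalars \<open>'b\<close> form a real normed field, so that both real-valued and complex-valued functions
  are covered.
\<close>

definition variable_exponents :: "('a::metric_space \<Rightarrow> real) set" where
  "variable_exponents = {p \<in> borel_measurable borel. \<forall>x. 1 \<le> p x}"

definition modular :: "'a measure \<Rightarrow> ('a \<Rightarrow> real) \<Rightarrow> ('a \<Rightarrow> 'b::real_normed_field) \<Rightarrow> ennreal" where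
  "modular M p f = (\<integral>\<^sup>+x. ennreal (norm (f x) powr p x) \<partial>M)"

definition Lp_fun :: "'a measure \<Rightarrow> ('a \<Rightarrow> real) \<Rightarrow> ('a \<Rightarrow> 'b::real_normed_field) set" where
  "Lp_fun M p = {f \<in> borel_measurable M. \<exists>\<eta>>0. modular M p (\<lambda>x. f x /\<^sub>R \<eta>) < \<infinity>}"

definition Lp_norm :: "'a measure \<Rightarrow> ('a \<Rightarrow> real) \<Rightarrow> ('a \<Rightarrow> 'b::real_normed_field) \<Rightarrow> real" where
  "Lp_norm M p f = Inf {\<eta>. \<eta> > 0 \<and> modular M p (\<lambda>x. f x /\<^sub>R \<eta>) \<le> 1}"

text \<open>The normed space proper consists of the classes modulo equality almost everywhere.\<close>

definition Lp_rel :: "'a measure \<Rightarrow> ('a \<Rightarrow> real) \<Rightarrow> (('a \<Rightarrow> 'b::real_normed_field) \<times> ('a \<Rightarrow> 'b)) set" where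
  "Lp_rel M p = {(f, g). f \<in> Lp_fun M p \<and> g \<in> Lp_fun M p \<and> (AE x in M. f x = g x)}"

definition Lp_class :: "'a measure \<Rightarrow> ('a \<Rightarrow> real) \<Rightarrow> ('a \<Rightarrow> 'b::real_normed_field) \<Rightarrow> ('a \<Rightarrow> 'b) set" where
  "Lp_class M p f = Lp_rel M p `` {f}"

definition Lp_space :: "'a measure \<Rightarrow> ('a \<Rightarrow> real) \<Rightarrow> ('a \<Rightarrow> 'b::real_normed_field) set set" where
  "Lp_space M p = Lp_fun M p // Lp_rel M p"

text \<open>
  The value 0 outside the carrier is needed because the locale \<^locale>\<open>Metric_space\<close> demands
  nonnegativity of the distance everywhere.
\<close>

definition Lp_dist ::
  "'a measure \<Rightarrow> ('a \<Rightarrow> real) \<Rightarrow> ('a \<Rightarrow> 'b::real_normed_field) set \<Rightarrow> ('a \<Rightarrow> 'b) set \<Rightarrow> real" where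
  "Lp_dist M p F G =
    (if F \<in> Lp_space M p \<and> G \<in> Lp_space M p
     then Lp_norm M p (\<lambda>x. (SOME f. f \<in> F) x - (SOME g. g \<in> G) x) else 0)"

abbreviation Lp_topology :: "'a measure \<Rightarrow> ('a \<Rightarrow> real) \<Rightarrow> ('a \<Rightarrow> 'b::real_normed_field) set topology" where
  "Lp_topology M p \<equiv> Metric_space.mtopology (Lp_space M p) (Lp_dist M p)"

text \<open>
  Operators are given on functions. One that is linear and bounded in the sense below maps
  functions equal almost everywhere to functions equal almost everywhere, hence acts on the classes.
\<close>

definition composition_operator :: "('a \<Rightarrow> 'a) \<Rightarrow> ('a \<Rightarrow> 'b) \<Rightarrow> ('a \<Rightarrow> 'b)" where
  "composition_operator \<phi> f = f \<circ> \<phi>"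

definition Lp_bounded_operator ::
  "'a measure \<Rightarrow> ('a \<Rightarrow> real) \<Rightarrow> (('a \<Rightarrow> 'b::real_normed_field) \<Rightarrow> ('a \<Rightarrow> 'b)) \<Rightarrow> bool" where
  "Lp_bounded_operator M p T \<longleftrightarrow>
    (\<forall>f\<in>Lp_fun M p. T f \<in> Lp_fun M p) \<and>
    (\<forall>f\<in>Lp_fun M p. \<forall>g\<in>Lp_fun M p. AE x in M. T (\<lambda>y. f y + g y) x = T f x + T g x) \<and>
    (\<forall>f\<in>Lp_fun M p. \<forall>c. AE x in M. T (\<lambda>y. c * f y) x = c * T f x) \<and>
    (\<exists>K. \<forall>f\<in>Lp_fun M p. Lp_norm M p (T f) \<le> K * Lp_norm M p f)"

definition Lp_nonzero_operator ::
  "'a measure \<Rightarrow> ('a \<Rightarrow> real) \<Rightarrow> (('a \<Rightarrow> 'b::real_normed_field) \<Rightarrow> ('a \<Rightarrow> 'b)) \<Rightarrow> bool" where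
  "Lp_nonzero_operator M p T \<longleftrightarrow> (\<exists>f\<in>Lp_fun M p. \<not> (AE x in M. T f x = 0))"

definition Lp_compact_operator ::
  "'a measure \<Rightarrow> ('a \<Rightarrow> real) \<Rightarrow> (('a \<Rightarrow> 'b::real_normed_field) \<Rightarrow> ('a \<Rightarrow> 'b)) \<Rightarrow> bool" where
  "Lp_compact_operator M p T \<longleftrightarrow>
    Lp_bounded_operator M p T \<and>
    compactin (Lp_topology M p)
      (Lp_topology M p closure_of
        {Lp_class M p (T f) |f. f \<in> Lp_fun M p \<and> Lp_norm M p f \<le> 1})"

text \<open>\<^const>\<open>Lp_dist\<close> is indeed a metric on the classes.\<close>

locale Lp_exponent =
  fixes M :: "'a measure" and p :: "'a \<Rightarrow> real"
  assumes p_meas [measurable]: "p \<in> borel_measurable M" and p_ge1: "1 \<le> p x"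
begin

lemma modular_scale:
  fixes f :: "'a \<Rightarrow> 'b::{real_normed_field,second_countable_topology}"
  assumes [measurable]: "f \<in> borel_measurable M" and ab: "0 < a" "a \<le> b"
  shows "modular M p (\<lambda>x. f x /\<^sub>R b) \<le> ennreal (a / b) * modular M p (\<lambda>x. f x /\<^sub>R a)"
proof -
  have "norm (f x /\<^sub>R b) powr p x \<le> (a / b) * norm (f x /\<^sub>R a) powr p x" for x
  proof -
    have b: "b > 0" using ab by simp
    have "norm (f x /\<^sub>R b) = (a / b) * norm (f x /\<^sub>R a)"
      using ab b by (simp add: field_simps)
    then have "norm (f x /\<^sub>R b) powr p x = (a / b) powr p x * norm (f x /\<^sub>R a) powr p x"
      using powr_mult[of "a / b" "norm (f x /\<^sub>R a)" "p x"] ab b by simp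
    moreover have "(a / b) powr p x \<le> (a / b) powr 1"
      using ab b p_ge1[of x] by (intro powr_mono') auto
    ultimately show ?thesis
      using ab b by (metis divide_nonneg_pos less_imp_le mult_right_mono powr_ge_zero powr_one)
  qed
  then have "modular M p (\<lambda>x. f x /\<^sub>R b)
      \<le> (\<integral>\<^sup>+x. ennreal (a / b) * ennreal (norm (f x /\<^sub>R a) powr p x) \<partial>M)"
    unfolding modular_def using ab
    by (intro nn_integral_mono) (simp add: ennreal_mult'[symmetric] ennreal_leI)
  also have "\<dots> = ennreal (a / b) * modular M p (\<lambda>x. f x /\<^sub>R a)"
    unfolding modular_def by (intro nn_integral_cmult) measurable
  finally show ?thesis .
qed

lemma modular_mono:
  fixes f :: "'a \<Rightarrow> 'b::{real_normed_field,second_countable_topology}"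
  assumes "f \<in> borel_measurable M" "0 < a" "a \<le> b" "modular M p (\<lambda>x. f x /\<^sub>R a) \<le> 1"
  shows "modular M p (\<lambda>x. f x /\<^sub>R b) \<le> 1"
proof -
  have "modular M p (\<lambda>x. f x /\<^sub>R b) \<le> ennreal (a / b) * modular M p (\<lambda>x. f x /\<^sub>R a)"
    by (rule modular_scale) (use assms in auto)
  also have "\<dots> \<le> 1 * 1"
    by (intro mult_mono) (use assms in auto)
  finally show ?thesis by simp
qed

lemma Lp_fun_unit:
  fixes f :: "'a \<Rightarrow> 'b::{real_normed_field,second_countable_topology}"
  assumes "f \<in> Lp_fun M p"
  shows "{\<eta>. \<eta> > 0 \<and> modular M p (\<lambda>x. f x /\<^sub>R \<eta>) \<le> 1} \<noteq> {}"
proof -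
  obtain a where a: "a > 0" "modular M p (\<lambda>x. f x /\<^sub>R a) < \<infinity>" and f: "f \<in> borel_measurable M"
    using assms by (auto simp: Lp_fun_def)
  then obtain r where r: "r \<ge> 0" "modular M p (\<lambda>x. f x /\<^sub>R a) = ennreal r"
    by (cases "modular M p (\<lambda>x. f x /\<^sub>R a)") auto
  define b where "b = a * (r + 1)"
  have b: "a \<le> b" "b > 0" using a r by (auto simp: b_def algebra_simps intro!: add_pos_nonneg)
  have "modular M p (\<lambda>x. f x /\<^sub>R b) \<le> ennreal (a / b) * ennreal r"
    using modular_scale[OF f a(1) b(1)] r by simp
  also have "\<dots> = ennreal (a / b * r)"
    using a b r by (intro ennreal_mult''[symmetric]) auto
  also have "\<dots> \<le> 1"
    unfolding ennreal_le_1 using a b r by (simp add: b_def field_simps)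
  finally show ?thesis using b by blast
qed

lemma Lp_norm_nonneg:
  fixes f :: "'a \<Rightarrow> 'b::{real_normed_field,second_countable_topology}"
  assumes "f \<in> Lp_fun M p"
  shows "0 \<le> Lp_norm M p f"
  unfolding Lp_norm_def by (rule cInf_greatest[OF Lp_fun_unit[OF assms]]) auto

lemma Lp_norm_less:
  fixes f :: "'a \<Rightarrow> 'b::{real_normed_field,second_countable_topology}"
  assumes f: "f \<in> Lp_fun M p" and "Lp_norm M p f < a"
  shows "a > 0" "modular M p (\<lambda>x. f x /\<^sub>R a) \<le> 1"
proof -
  obtain b where "b < a" "b > 0" "modular M p (\<lambda>x. f x /\<^sub>R b) \<le> 1"
    using cInf_lessD[OF Lp_fun_unit[OF f]] assms(2) unfolding Lp_norm_def by blast
  then show "a > 0" "modular M p (\<lambda>x. f x /\<^sub>R a) \<le> 1"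
    using modular_mono[of f b a] f by (auto simp: Lp_fun_def)
qed

lemma Lp_norm_le:
  assumes "a > 0" "modular M p (\<lambda>x. f x /\<^sub>R a) \<le> 1"
  shows "Lp_norm M p f \<le> a"
  unfolding Lp_norm_def by (rule cInf_lower) (use assms in \<open>auto intro!: bdd_belowI[of _ 0]\<close>)

lemma powr_convex_nonneg:
  assumes "1 \<le> q" "0 \<le> s" "0 \<le> t" "0 \<le> u" "0 \<le> v" "u + v = (1::real)"
  shows "(u * s + v * t) powr q \<le> u * s powr q + v * t powr q"
proof (cases "u = 0 \<or> v = 0 \<or> s = 0 \<or> t = 0")
  case True
  have *: "(w * z) powr q \<le> w * z powr q" if "0 \<le> w" "w \<le> 1" "0 \<le> z" for w z :: real
  proof (cases "w = 0")
    case False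
    have "w powr q \<le> w powr 1"
      using that assms False by (intro powr_mono') auto
    then show ?thesis using that by (simp add: powr_mult mult_right_mono)
  qed simp
  then show ?thesis using True assms *[of u s] *[of v t] by auto
next
  case False
  then have st: "s > 0" "t > 0" "v \<le> 1" and u: "u = 1 - v"
    using assms by auto
  show ?thesis
    unfolding u using convex_onD[OF powr_convex[OF assms(1)], of v s t] st assms(5) by simp
qed

lemma modular_add:
  fixes f g :: "'a \<Rightarrow> 'b::{real_normed_field,second_countable_topology}"
  assumes [measurable]: "f \<in> borel_measurable M" "g \<in> borel_measurable M"
    and a: "a > 0" "modular M p (\<lambda>x. f x /\<^sub>R a) \<le> 1"
    and b: "b > 0" "modular M p (\<lambda>x. g x /\<^sub>R b) \<le> 1"
  shows "modular M p (\<lambda>x. (f x + g x) /\<^sub>R (a + b)) \<le> 1"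
proof -
  define u v where "u = a / (a + b)" and "v = b / (a + b)"
  have uv: "u \<ge> 0" "v \<ge> 0" "u + v = 1"
    using a b by (auto simp: u_def v_def add_divide_distrib[symmetric])
  have le: "norm ((f x + g x) /\<^sub>R (a + b)) powr p x
      \<le> u * norm (f x /\<^sub>R a) powr p x + v * norm (g x /\<^sub>R b) powr p x" for x
  proof -
    have "norm ((f x + g x) /\<^sub>R (a + b)) = norm (f x + g x) / (a + b)"
      unfolding norm_scaleR using a b by (simp add: divide_inverse mult.commute)
    also have "\<dots> \<le> (norm (f x) + norm (g x)) / (a + b)"
      using a b norm_triangle_ineq[of "f x" "g x"] by (intro divide_right_mono) auto
    also have "\<dots> = u * norm (f x /\<^sub>R a) + v * norm (g x /\<^sub>R b)"
    proof -
      have "u * norm (f x /\<^sub>R a) = norm (f x) / (a + b)" "v * norm (g x /\<^sub>R b) = norm (g x) / (a + b)"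
        unfolding norm_scaleR u_def v_def using a b by (simp_all add: divide_inverse)
      then show ?thesis by (simp add: add_divide_distrib)
    qed
    finally have "norm ((f x + g x) /\<^sub>R (a + b)) powr p x
        \<le> (u * norm (f x /\<^sub>R a) + v * norm (g x /\<^sub>R b)) powr p x"
      using p_ge1[of x] by (intro powr_mono2) auto
    also have "\<dots> \<le> u * norm (f x /\<^sub>R a) powr p x + v * norm (g x /\<^sub>R b) powr p x"
      using uv p_ge1[of x] by (intro powr_convex_nonneg) auto
    finally show ?thesis .
  qed
  have "modular M p (\<lambda>x. (f x + g x) /\<^sub>R (a + b))
      \<le> (\<integral>\<^sup>+x. ennreal u * ennreal (norm (f x /\<^sub>R a) powr p x)
           + ennreal v * ennreal (norm (g x /\<^sub>R b) powr p x) \<partial>M)"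
    unfolding modular_def
  proof (rule nn_integral_mono)
    fix x
    have "ennreal (norm ((f x + g x) /\<^sub>R (a + b)) powr p x)
      \<le> ennreal (u * norm (f x /\<^sub>R a) powr p x + v * norm (g x /\<^sub>R b) powr p x)"
      using le by (rule ennreal_leI)
    also have "\<dots> = ennreal u * ennreal (norm (f x /\<^sub>R a) powr p x)
           + ennreal v * ennreal (norm (g x /\<^sub>R b) powr p x)"
      using uv by (simp add: ennreal_mult' ennreal_plus del: norm_scaleR)
    finally show "ennreal (norm ((f x + g x) /\<^sub>R (a + b)) powr p x)
      \<le> ennreal u * ennreal (norm (f x /\<^sub>R a) powr p x)
           + ennreal v * ennreal (norm (g x /\<^sub>R b) powr p x)" .
  qed
  also have "\<dots> = ennreal u * modular M p (\<lambda>x. f x /\<^sub>R a) + ennreal v * modular M p (\<lambda>x. g x /\<^sub>R b)"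
    unfolding modular_def
    by (subst nn_integral_add) (auto simp: nn_integral_cmult simp del: norm_scaleR)
  also have "\<dots> \<le> ennreal u * 1 + ennreal v * 1"
    using a b by (intro add_mono mult_left_mono) auto
  also have "\<dots> = 1"
    using uv by (simp add: ennreal_plus[symmetric] del: ennreal_plus)
  finally show ?thesis .
qed

lemma Lp_fun_add:
  fixes f g :: "'a \<Rightarrow> 'b::{real_normed_field,second_countable_topology}"
  assumes "f \<in> Lp_fun M p" "g \<in> Lp_fun M p"
  shows "(\<lambda>x. f x + g x) \<in> Lp_fun M p"
proof -
  obtain a b where "a > 0" "modular M p (\<lambda>x. f x /\<^sub>R a) \<le> 1" "b > 0" "modular M p (\<lambda>x. g x /\<^sub>R b) \<le> 1"
    using Lp_fun_unit[OF assms(1)] Lp_fun_unit[OF assms(2)] by blast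
  moreover have [measurable]: "f \<in> borel_measurable M" "g \<in> borel_measurable M"
    using assms by (auto simp: Lp_fun_def)
  ultimately have "modular M p (\<lambda>x. (f x + g x) /\<^sub>R (a + b)) \<le> 1" "a + b > 0"
    using modular_add[of f g a b] by auto
  then show ?thesis
    by (auto simp: Lp_fun_def intro!: exI[of _ "a + b"] elim: le_less_trans)
qed

lemma Lp_norm_add:
  fixes f g :: "'a \<Rightarrow> 'b::{real_normed_field,second_countable_topology}"
  assumes f: "f \<in> Lp_fun M p" and g: "g \<in> Lp_fun M p"
  shows "Lp_norm M p (\<lambda>x. f x + g x) \<le> Lp_norm M p f + Lp_norm M p g"
proof (rule field_le_epsilon)
  fix e :: real assume "e > 0"
  define a b where "a = Lp_norm M p f + e / 2" and "b = Lp_norm M p g + e / 2"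
  have "a > 0" "modular M p (\<lambda>x. f x /\<^sub>R a) \<le> 1" "b > 0" "modular M p (\<lambda>x. g x /\<^sub>R b) \<le> 1"
    using Lp_norm_less[OF f, of a] Lp_norm_less[OF g, of b] \<open>e > 0\<close> by (auto simp: a_def b_def)
  then have "Lp_norm M p (\<lambda>x. f x + g x) \<le> a + b"
    using modular_add[of f g a b] f g by (intro Lp_norm_le) (auto simp: Lp_fun_def)
  then show "Lp_norm M p (\<lambda>x. f x + g x) \<le> Lp_norm M p f + Lp_norm M p g + e"
    by (simp add: a_def b_def)
qed

lemma modular_uminus: "modular M p (\<lambda>x. (- f x) /\<^sub>R a) = modular M p (\<lambda>x. f x /\<^sub>R a)"
  by (simp add: modular_def)

lemma Lp_fun_uminus:
  fixes f :: "'a \<Rightarrow> 'b::{real_normed_field,second_countable_topology}"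
  shows "f \<in> Lp_fun M p \<Longrightarrow> (\<lambda>x. - f x) \<in> Lp_fun M p"
  unfolding Lp_fun_def by (simp only: mem_Collect_eq modular_uminus) simp

lemma Lp_norm_uminus: "Lp_norm M p (\<lambda>x. - f x) = Lp_norm M p f"
  unfolding Lp_norm_def modular_uminus ..

lemma Lp_norm_diff_commute: "Lp_norm M p (\<lambda>x. f x - g x) = Lp_norm M p (\<lambda>x. g x - f x)"
  using Lp_norm_uminus[of "\<lambda>x. f x - g x"] by simp

lemma Lp_fun_diff:
  fixes f g :: "'a \<Rightarrow> 'b::{real_normed_field,second_countable_topology}"
  shows "f \<in> Lp_fun M p \<Longrightarrow> g \<in> Lp_fun M p \<Longrightarrow> (\<lambda>x. f x - g x) \<in> Lp_fun M p"
  using Lp_fun_add[of f "\<lambda>x. - g x"] Lp_fun_uminus[of g] by simp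

lemma Lp_norm_cong:
  assumes "AE x in M. f x = g x"
  shows "Lp_norm M p f = Lp_norm M p g"
proof -
  have "modular M p (\<lambda>x. f x /\<^sub>R a) = modular M p (\<lambda>x. g x /\<^sub>R a)" for a
    unfolding modular_def by (rule nn_integral_cong_AE) (use assms in auto)
  then show ?thesis by (simp add: Lp_norm_def)
qed

lemma Lp_norm_eq_0_iff:
  fixes f :: "'a \<Rightarrow> 'b::{real_normed_field,second_countable_topology}"
  assumes f: "f \<in> Lp_fun M p"
  shows "Lp_norm M p f = 0 \<longleftrightarrow> (AE x in M. f x = 0)"
proof
  have m [measurable]: "f \<in> borel_measurable M" using f by (auto simp: Lp_fun_def)
  assume *: "Lp_norm M p f = 0"
  have le: "modular M p (\<lambda>x. f x /\<^sub>R 1) \<le> ennreal e" if e: "0 < e" "e < 1" for e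
  proof -
    have "modular M p (\<lambda>x. f x /\<^sub>R 1) \<le> ennreal (e / 1) * modular M p (\<lambda>x. f x /\<^sub>R e)"
      using e by (intro modular_scale m) auto
    also have "\<dots> \<le> ennreal (e / 1) * 1"
      using Lp_norm_less[OF f, of e] * e by (intro mult_left_mono) auto
    finally show ?thesis by simp
  qed
  have "modular M p (\<lambda>x. f x /\<^sub>R 1) = 0"
  proof (rule ccontr)
    assume "modular M p (\<lambda>x. f x /\<^sub>R 1) \<noteq> 0"
    moreover have "modular M p (\<lambda>x. f x /\<^sub>R 1) < top"
      by (rule le_less_trans[OF le[of "1 / 2"] ennreal_less_top]) auto
    ultimately obtain t where t: "t > 0" "modular M p (\<lambda>x. f x /\<^sub>R 1) = ennreal t"
      by (cases "modular M p (\<lambda>x. f x /\<^sub>R 1)") (auto simp: less_le simp del: inverse_1)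
    have *: "t \<le> e" if "0 < e" "e < 1" for e
      using le[OF that] that unfolding t(2) by (subst (asm) ennreal_le_iff) auto
    show False
      using *[of "1 / 2"] *[of "t / 2"] t(1) by simp
  qed
  then have "AE x in M. ennreal (norm (f x) powr p x) = 0"
    by (subst (asm) modular_def, subst (asm) nn_integral_0_iff_AE) auto
  then show "AE x in M. f x = 0"
    by eventually_elim (simp add: ennreal_eq_0_iff)
next
  assume "AE x in M. f x = 0"
  then have "Lp_norm M p f = Lp_norm M p (\<lambda>_. 0::'b)" by (rule Lp_norm_cong)
  also have "\<dots> = Inf {0<..}"
    by (simp add: Lp_norm_def modular_def greaterThan_def)
  finally show "Lp_norm M p f = 0" by simp
qed

lemma equiv_Lp_rel: "equiv (Lp_fun M p) (Lp_rel M p)"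
proof (rule equivI)
  show "Lp_rel M p \<subseteq> Lp_fun M p \<times> Lp_fun M p"
    by (auto simp: Lp_rel_def)
  show "refl_on (Lp_fun M p) (Lp_rel M p)"
    by (auto simp: Lp_rel_def refl_on_def)
  show "sym (Lp_rel M p)"
    by (rule symI) (auto simp: Lp_rel_def elim: eventually_mono)
  show "trans (Lp_rel M p)"
    by (rule transI) (auto simp: Lp_rel_def elim: eventually_elim2)
qed

lemma Lp_class_in_space: "f \<in> Lp_fun M p \<Longrightarrow> Lp_class M p f \<in> Lp_space M p"
  unfolding Lp_class_def Lp_space_def by (rule quotientI)

lemma Lp_space_cases:
  assumes "F \<in> Lp_space M p"
  obtains f where "f \<in> Lp_fun M p" "F = Lp_class M p f"
  using assms unfolding Lp_class_def Lp_space_def by (auto elim: quotientE)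

lemma Lp_class_eq_iff:
  "f \<in> Lp_fun M p \<Longrightarrow> g \<in> Lp_fun M p \<Longrightarrow> Lp_class M p f = Lp_class M p g \<longleftrightarrow> (AE x in M. f x = g x)"
  using eq_equiv_class_iff[OF equiv_Lp_rel] unfolding Lp_class_def by (auto simp: Lp_rel_def)

lemma Lp_dist_class:
  fixes f g :: "'a \<Rightarrow> 'b::{real_normed_field,second_countable_topology}"
  assumes "f \<in> Lp_fun M p" "g \<in> Lp_fun M p"
  shows "Lp_dist M p (Lp_class M p f) (Lp_class M p g) = Lp_norm M p (\<lambda>x. f x - g x)"
proof -
  have *: "AE x in M. (SOME k. k \<in> Lp_class M p h) x = h x" if "h \<in> Lp_fun M p" for h :: "'a \<Rightarrow> 'b"
  proof -
    have "h \<in> Lp_class M p h" using that by (auto simp: Lp_class_def Lp_rel_def)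
    then have "(SOME k. k \<in> Lp_class M p h) \<in> Lp_class M p h" by (rule someI[of "\<lambda>k. k \<in> Lp_class M p h"])
    then show ?thesis by (auto simp: Lp_class_def Lp_rel_def elim: eventually_mono)
  qed
  show ?thesis
    unfolding Lp_dist_def using *[OF assms(1)] *[OF assms(2)] assms
    by (auto simp: Lp_class_in_space intro!: Lp_norm_cong elim: eventually_elim2)
qed

lemma Metric_space_Lp:
  "Metric_space (Lp_space M p :: ('a \<Rightarrow> 'b::{real_normed_field,second_countable_topology}) set set) (Lp_dist M p)"
proof
  fix F G H :: "('a \<Rightarrow> 'b) set"
  show "0 \<le> Lp_dist M p F G"
  proof (cases "F \<in> Lp_space M p \<and> G \<in> Lp_space M p")
    case True
    then show ?thesis
      by (elim conjE Lp_space_cases) (auto simp: Lp_dist_class intro!: Lp_norm_nonneg Lp_fun_diff)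
  qed (auto simp: Lp_dist_def)
  show "Lp_dist M p F G = Lp_dist M p G F"
    unfolding Lp_dist_def using Lp_norm_diff_commute by auto
  assume "F \<in> Lp_space M p" "G \<in> Lp_space M p"
  then obtain f g where fg: "f \<in> Lp_fun M p" "F = Lp_class M p f" "g \<in> Lp_fun M p" "G = Lp_class M p g"
    by (elim Lp_space_cases)
  then show "(Lp_dist M p F G = 0) = (F = G)"
    by (simp add: Lp_dist_class Lp_class_eq_iff Lp_norm_eq_0_iff Lp_fun_diff)
  assume "H \<in> Lp_space M p"
  then obtain h where h: "h \<in> Lp_fun M p" "H = Lp_class M p h" by (elim Lp_space_cases)
  have "Lp_norm M p (\<lambda>x. f x - h x) \<le> Lp_norm M p (\<lambda>x. f x - g x) + Lp_norm M p (\<lambda>x. g x - h x)"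
    using Lp_norm_add[OF Lp_fun_diff[OF fg(1,3)] Lp_fun_diff[OF fg(3) h(1)]] by simp
  then show "Lp_dist M p F H \<le> Lp_dist M p F G + Lp_dist M p G H"
    using fg h by (simp add: Lp_dist_class)
qed

end

lemma (in metric_measure_space) Lp_exponent:
  "p \<in> variable_exponents \<Longrightarrow> Lp_exponent M p"
  using borel_sets sets.sets_into_space[of UNIV M]
  by (auto simp: variable_exponents_def measurable_def Lp_exponent_def)

end

theory Submission
  imports Defs
begin

text \<open>
  The obstruction to compactness is that indicator functions of subsets of a bounded set form a
  bounded family, while their images under \<open>f \<mapsto> f \<circ> \<phi>\<close> can be made to stay uniformly far apart.

  Take a ball \<open>E\<close> so large that \<open>A = E \<inter> \<phi> -` E\<close> has positive measure, and put
  \<open>N F = \<mu> (A \<inter> \<phi> -` F)\<close>. The functions \<open>1\<^sub>F\<close> with \<open>F \<subseteq> E\<close>, multiplied by one constant, lie in the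
  unit ball. The images of \<open>1\<^sub>F\<close> and \<open>1\<^sub>G\<close> differ by \<open>1\<close> in absolute value on the part
  \<open>A \<inter> \<phi> -` (F \<triangle> G)\<close> of \<open>A\<close>, whose measure is \<open>N (F \<triangle> G)\<close>. Because all
  exponents are at least 1, the Luxemburg norm of a function that is large on a set of measure \<open>b\<close>
  is bounded below in terms of \<open>b\<close>, whatever the exponents are (\<open>Lp_norm_lower_bound\<close>). The two
  exponents \<open>p x\<close> and \<open>p (\<phi> x)\<close> need not be comparable, so concentrating functions on small sets,
  the usual test for a constant exponent, might fail; sets of fixed size that oscillate avoid this.

  It remains to see that the Borel sets are not totally bounded for the pseudometric
  \<open>N (F \<triangle> G)\<close>. Given finitely many sets, one can choose \<open>F\<close> that cuts each cell of the algebra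
  generated by them, in a balanced way, so that \<open>F\<close> has distance at least
  \<open>N UNIV / 3\<close> from each of them (\<open>exists_subset_far_from_finite_family\<close>). Such cuts exist as
  soon as the space is a countable union of sets of small \<open>N\<close>-measure
  (\<open>small_countable_cover\<close>). This uses two facts: points are \<open>N\<close>-null, since they are \<open>\<mu>\<close>-null by
  Ahlfors regularity with \<open>Q > 0\<close> and \<open>\<phi>\<close> is non-singular; and the space is separable, since balls
  have positive finite measure.
\<close>

section \<open>Measures without atoms on a separable metric space\<close>

text \<open>
  The balls of radius \<open>r / 2\<close> about the points of a separated set are disjoint and have positive
  measure. Those with centre in a fixed ball lie in a set of finite measure, so their measures are
  summable, and a summable family of positive numbers is countable.
\<close>

lemma (in metric_measure_space) countable_separated:
  fixes S :: "'a set"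
  assumes r: "r > 0" and sep: "\<And>s t. s \<in> S \<Longrightarrow> t \<in> S \<Longrightarrow> s \<noteq> t \<Longrightarrow> r \<le> dist s t"
  shows "countable S"
proof -
  fix x0 :: 'a
  have cnt: "countable (S \<inter> ball x0 (real k))" for k
  proof -
    let ?S = "S \<inter> ball x0 (real k)" and ?B = "\<lambda>s. ball s (r / 2)" and ?V = "ball x0 (real k + r)"
    have meas: "open U \<Longrightarrow> U \<in> sets M" for U
      using borel_sets by auto
    have fin: "emeasure M (ball s t) \<noteq> \<infinity>" for s t
      using bounded_finite[OF meas[OF open_ball] bounded_ball, of s t] by simp
    have "dist s t \<ge> r" if "s \<in> S" "t \<in> S" "s \<noteq> t" for s t
      using sep that by blast
    then have disj: "disjoint_family_on ?B ?S"
      using r unfolding disjoint_family_on_def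
      by (auto simp: disjoint_iff) (smt (verit) dist_commute dist_triangle field_sum_of_halves)
    have "(\<lambda>s. measure M (?B s)) summable_on ?S"
    proof (rule nonneg_bdd_above_summable_on)
      show "bdd_above (sum (\<lambda>s. measure M (?B s)) ` {F. F \<subseteq> ?S \<and> finite F})"
      proof (rule bdd_aboveI2[where M = "measure M ?V"])
        fix F assume "F \<in> {F. F \<subseteq> ?S \<and> finite F}"
        then have F: "finite F" "F \<subseteq> ?S" by auto
        have "(\<Sum>s\<in>F. measure M (?B s)) = measure M (\<Union>s\<in>F. ?B s)"
          using F disjoint_family_on_mono[OF F(2) disj] fin meas
          by (intro measure_finite_Union[symmetric]) auto
        also have "\<dots> \<le> measure M ?V"
        proof (rule measure_mono_fmeasurable)
          show "(\<Union>s\<in>F. ?B s) \<subseteq> ?V"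
          proof
            fix y assume "y \<in> (\<Union>s\<in>F. ?B s)"
            then obtain s where "s \<in> F" "dist s y < r / 2" by auto
            moreover from this F have "dist x0 s < real k" by auto
            ultimately show "y \<in> ?V"
              using dist_triangle[of x0 y s] r by auto
          qed
          show "(\<Union>s\<in>F. ?B s) \<in> sets M" by (intro meas) auto
          show "?V \<in> fmeasurable M"
            using fin meas by (auto simp: fmeasurable_def top.not_eq_extremum)
        qed
        finally show "(\<Sum>s\<in>F. measure M (?B s)) \<le> measure M ?V" .
      qed
    qed auto
    then have "countable {s \<in> ?S. measure M (?B s) \<noteq> 0}"
      by (rule summable_countable_real)
    moreover have "measure M (?B s) \<noteq> 0" for s
      using open_pos[of "?B s"] fin[of s "r / 2"] r
      by (auto simp: measure_def enn2real_eq_0_iff)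
    moreover have "{s \<in> ?S. measure M (?B s) \<noteq> 0} = ?S" using calculation(2) by blast
    ultimately show ?thesis by metis
  qed
  have "S = (\<Union>k. S \<inter> ball x0 (real k))"
    using reals_Archimedean2 by auto
  with cnt show ?thesis
    by (metis countable_UN uncountable_def countableI_type)
qed

text \<open>A maximal \<open>r\<close>-separated subset of \<open>Y\<close> is an \<open>r\<close>-net of \<open>Y\<close>.\<close>

lemma (in metric_measure_space) countable_net:
  fixes Y :: "'a set"
  assumes r: "r > 0"
  obtains S where "countable S" "S \<subseteq> Y" "Y \<subseteq> (\<Union>s\<in>S. ball s r)"
proof -
  define \<A> where "\<A> = {S. S \<subseteq> Y \<and> (\<forall>s\<in>S. \<forall>t\<in>S. s \<noteq> t \<longrightarrow> r \<le> dist s t)}"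
  have "\<exists>S\<in>\<A>. \<forall>T\<in>\<A>. S \<subseteq> T \<longrightarrow> T = S"
  proof (rule subset_Zorn')
    fix \<C> assume C: "subset.chain \<A> \<C>"
    have "r \<le> dist s t" if st: "s \<in> \<Union>\<C>" "t \<in> \<Union>\<C>" "s \<noteq> t" for s t
    proof -
      obtain S T where "S \<in> \<C>" "T \<in> \<C>" "s \<in> S" "t \<in> T" using st by auto
      moreover from this have "S \<subseteq> T \<or> T \<subseteq> S" "S \<in> \<A>" "T \<in> \<A>"
        using C by (auto simp: subset_chain_def)
      ultimately show ?thesis using st(3) unfolding \<A>_def by blast
    qed
    then show "\<Union>\<C> \<in> \<A>" using C by (auto simp: \<A>_def subset_chain_def)
  qed
  then obtain S where S: "S \<in> \<A>" and max: "\<And>T. T \<in> \<A> \<Longrightarrow> S \<subseteq> T \<Longrightarrow> T = S" by blast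
  have "Y \<subseteq> (\<Union>s\<in>S. ball s r)"
  proof
    fix y assume y: "y \<in> Y"
    show "y \<in> (\<Union>s\<in>S. ball s r)"
    proof (rule ccontr)
      assume "y \<notin> (\<Union>s\<in>S. ball s r)"
      then have far: "r \<le> dist s y" if "s \<in> S" for s using that by force
      then have "insert y S \<in> \<A>"
        using S y by (auto simp: \<A>_def dist_commute)
      then have "insert y S = S" by (rule max) auto
      then show False using far[of y] r by auto
    qed
  qed
  then show ?thesis
    using that[of S] countable_separated[OF r, of S] S by (auto simp: \<A>_def)
qed

text \<open>
  Each point has a ball of measure at most \<open>e\<close>, of a radius \<open>1 / (n + 1)\<close> that depends on the point.
  Sorting the points by \<open>n\<close> into sets \<open>Y n\<close>, a countable net of \<open>Y n\<close> inside \<open>Y n\<close> supplies the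
  centres.
\<close>

lemma (in metric_measure_space) small_countable_cover:
  fixes N :: "'a measure"
  assumes "finite_measure N" and N: "sets N = sets borel"
    and null: "\<And>x. measure N {x} = 0" and e: "e > 0"
  obtains U :: "nat \<Rightarrow> 'a set"
  where "range U \<subseteq> sets N" "(\<Union>i. U i) = UNIV" "\<And>i. measure N (U i) \<le> e"
proof -
  interpret N: finite_measure N by fact
  define Y where "Y n = {x. measure N (ball x (1 / real (Suc n))) \<le> e}" for n
  have cover: "\<exists>n. x \<in> Y n" for x
  proof -
    have "(\<Inter>n. ball x (1 / real (Suc n))) = {x}"
    proof (intro equalityI subsetI)
      fix y assume y: "y \<in> (\<Inter>n. ball x (1 / real (Suc n)))"
      show "y \<in> {x}"
      proof (rule ccontr)
        assume "y \<notin> {x}"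
        then obtain n where "1 / real (Suc n) < dist x y"
          using nat_approx_posE[of "dist x y"] by auto
        moreover have "dist x y < 1 / real (Suc n)" using y by (simp del: of_nat_Suc)
        ultimately show False by linarith
      qed
    qed (auto simp: field_simps)
    moreover have "(\<lambda>n. measure N (ball x (1 / real (Suc n))))
        \<longlonglongrightarrow> measure N (\<Inter>n. ball x (1 / real (Suc n)))"
      by (rule N.finite_Lim_measure_decseq)
        (auto simp: N decseq_def intro!: subset_ball frac_le)
    ultimately have "(\<lambda>n. measure N (ball x (1 / real (Suc n)))) \<longlonglongrightarrow> 0"
      by (simp add: null)
    then have "\<forall>\<^sub>F n in sequentially. measure N (ball x (1 / real (Suc n))) < e"
      using e by (rule order_tendstoD)
    then obtain n where "measure N (ball x (1 / real (Suc n))) < e"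
      using eventually_happens'[OF sequentially_bot] by blast
    then show ?thesis unfolding Y_def by (intro exI[of _ n]) simp
  qed
  have "\<forall>n. \<exists>S. countable S \<and> S \<subseteq> Y n \<and> Y n \<subseteq> (\<Union>s\<in>S. ball s (1 / real (Suc n)))"
  proof
    fix n
    obtain S where "countable S" "S \<subseteq> Y n" "Y n \<subseteq> (\<Union>s\<in>S. ball s (1 / real (Suc n)))"
      by (rule countable_net[of "1 / real (Suc n)" "Y n"]) simp
    then show "\<exists>S. countable S \<and> S \<subseteq> Y n \<and> Y n \<subseteq> (\<Union>s\<in>S. ball s (1 / real (Suc n)))"
      by (intro exI conjI)
  qed
  from choice[OF this] obtain S
    where "\<forall>n. countable (S n) \<and> S n \<subseteq> Y n \<and> Y n \<subseteq> (\<Union>s\<in>S n. ball s (1 / real (Suc n)))" ..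
  then have S: "countable (S n)" "S n \<subseteq> Y n" "Y n \<subseteq> (\<Union>s\<in>S n. ball s (1 / real (Suc n)))" for n
    by (simp_all del: of_nat_Suc)
  define \<B> where "\<B> = (\<Union>n. (\<lambda>s. ball s (1 / real (Suc n))) ` S n)"
  have "countable \<B>" unfolding \<B>_def using S(1) by (intro countable_UN countable_image) auto
  moreover have "x \<in> \<Union>\<B>" for x
  proof -
    obtain n where "x \<in> Y n" using cover by blast
    then obtain s where "s \<in> S n" "x \<in> ball s (1 / real (Suc n))" using S(3) by blast
    then show ?thesis unfolding \<B>_def by blast
  qed
  ultimately have B: "countable \<B>" "\<Union>\<B> = UNIV" by auto
  then have "\<B> \<noteq> {}" by auto
  then have range: "range (from_nat_into \<B>) = \<B>" using B by (simp add: range_from_nat_into)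
  show ?thesis
  proof (rule that[of "from_nat_into \<B>"])
    have "b \<in> sets N \<and> measure N b \<le> e" if "b \<in> \<B>" for b
    proof -
      from that obtain n s where "s \<in> S n" "b = ball s (1 / real (Suc n))"
        unfolding \<B>_def by blast
      then show ?thesis using S(2)[of n] by (auto simp: N Y_def simp del: of_nat_Suc)
    qed
    then show "range (from_nat_into \<B>) \<subseteq> sets N" "measure N (from_nat_into \<B> i) \<le> e" for i
      using range by blast+
  qed (use B range in auto)
qed

text \<open>
  The ball of radius \<open>s\<close> has diameter at most \<open>2 * s\<close>, so its measure is of order at most
  \<open>s powr Q\<close>, which vanishes with \<open>s\<close> because \<open>Q > 0\<close>.
\<close>

lemma (in metric_measure_space) ahlfors_regular_singleton_null:
  assumes Q: "Q > 0" and A: "ahlfors_regular M Q"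
  shows "emeasure M {x} = 0"
proof -
  obtain C where C: "C > 0" and
    le: "\<And>x r. r > 0 \<Longrightarrow> (bounded (UNIV::'a set) \<Longrightarrow> diameter (ball x r) \<le> 2 * diameter (UNIV::'a set))
      \<Longrightarrow> emeasure M (ball x r) \<le> ennreal (C * diameter (ball x r) powr Q)"
    using A unfolding ahlfors_regular_def by blast
  have bound: "emeasure M {x} \<le> ennreal (C * (2 * s) powr Q)" if s: "s > 0" for s
  proof -
    have "emeasure M {x} \<le> emeasure M (ball x s)"
      using borel_sets s by (intro emeasure_mono) auto
    also have "\<dots> \<le> ennreal (C * diameter (ball x s) powr Q)"
    proof (rule le[OF s])
      assume b: "bounded (UNIV::'a set)"
      have "diameter (ball x s) \<le> diameter (UNIV::'a set)"
        by (rule diameter_subset[OF _ b]) auto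
      then show "diameter (ball x s) \<le> 2 * diameter (UNIV::'a set)"
        using diameter_ge_0[OF b] by simp
    qed
    also have "\<dots> \<le> ennreal (C * (2 * s) powr Q)"
    proof -
      have "dist y z \<le> 2 * s" if "y \<in> ball x s" "z \<in> ball x s" for y z
        using that dist_triangle[of y z x] by (auto simp: dist_commute)
      then have "diameter (ball x s) \<le> 2 * s"
        using s unfolding diameter_def by (auto intro!: cSUP_least)
      then show ?thesis
        using C Q by (intro ennreal_leI mult_left_mono powr_mono2) (auto intro: diameter_ge_0)
    qed
    finally show ?thesis .
  qed
  have "emeasure M {x} \<le> ennreal e" if e: "e > 0" for e
    \<comment> \<open>the radius solves \<open>C * (2 * s) powr Q = e\<close>\<close>
    using bound[of "(e / C) powr (1 / Q) / 2"] e C Q by (simp add: powr_powr)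
  then show ?thesis
    by (metis ennreal_le_epsilon add_0 le_zero_eq zero_le)
qed

section \<open>A set that bisects finitely many given sets\<close>

text \<open>
  Adding pieces of measure at most a third of that of \<open>D\<close> one at a time, stop as soon as more than a
  third of \<open>D\<close> is collected: the last step adds at most another third, so at least a third is left.
\<close>

lemma (in finite_measure) exists_balanced_subset:
  assumes small: "\<And>e. e > 0 \<Longrightarrow>
      \<exists>U::nat \<Rightarrow> 'a set. range U \<subseteq> sets M \<and> (\<Union>i. U i) = space M \<and> (\<forall>i. measure M (U i) \<le> e)"
    and D: "D \<in> sets M"
  obtains F where "F \<in> sets M" "F \<subseteq> D" "measure M D / 3 \<le> measure M F"
    "measure M D / 3 \<le> measure M (D - F)"
proof (cases "measure M D = 0")
  case True
  then show ?thesis using that[of "{}"] by simp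
next
  case False
  define m where "m = measure M D"
  have m: "m > 0" using False by (simp add: m_def zero_less_measure_iff)
  obtain U :: "nat \<Rightarrow> 'a set" where U: "range U \<subseteq> sets M" "(\<Union>i. U i) = space M"
    "\<And>i. measure M (U i) \<le> m / 3"
    using small[of "m / 3"] m by auto
  define A where "A n = D \<inter> (\<Union>i<n. U i)" for n
  have A: "A n \<in> sets M" for n using D U(1) by (auto simp: A_def)
  have "incseq A" unfolding incseq_def A_def by fastforce
  then have "(\<lambda>n. measure M (A n)) \<longlonglongrightarrow> measure M (\<Union>n. A n)"
    using A by (intro finite_Lim_measure_incseq) auto
  moreover have "(\<Union>n. A n) = D"
  proof -
    have "\<exists>n. x \<in> A n" if x: "x \<in> D" for x
    proof -
      obtain i where "x \<in> U i" using U(2) sets.sets_into_space[OF D] x by blast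
      with x have "x \<in> A (Suc i)" by (auto simp: A_def)
      then show ?thesis ..
    qed
    then show ?thesis by (auto simp: A_def)
  qed
  ultimately have "\<forall>\<^sub>F n in sequentially. m / 3 < measure M (A n)"
    using m by (intro order_tendstoD) (auto simp: m_def)
  then have ex: "\<exists>n. m / 3 < measure M (A n)" by (rule eventually_happens'[OF sequentially_bot])
  define n where "n = (LEAST n. m / 3 < measure M (A n))"
  have n: "m / 3 < measure M (A n)" unfolding n_def by (rule LeastI_ex[OF ex])
  have "n \<noteq> 0"
  proof
    assume "n = 0"
    then have "A n = {}" by (simp add: A_def)
    with n m show False by simp
  qed
  then obtain k where k: "n = Suc k" using not0_implies_Suc by blast
  have "measure M (A k) \<le> m / 3"
    using not_less_Least[of k "\<lambda>n. m / 3 < measure M (A n)"] k by (simp add: n_def)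
  moreover have "measure M (A n) \<le> measure M (A k \<union> U k)"
    using A U(1) by (intro finite_measure_mono) (auto simp: A_def k less_Suc_eq)
  moreover have "\<dots> \<le> measure M (A k) + measure M (U k)"
    using A U(1) by (intro measure_Un_le) auto
  ultimately have "measure M (A n) \<le> 2 * (m / 3)" using U(3)[of k] by simp
  moreover have "measure M (D - A n) = m - measure M (A n)"
    unfolding m_def using A D by (intro finite_measure_Diff) (auto simp: A_def)
  ultimately show ?thesis
    using that[of "A n"] n A[of n] by (simp add: A_def m_def)
qed

text \<open>
  The set \<open>F\<close> cuts every \<open>D \<inter> G\<close> and every \<open>D - G\<close>, although the sets \<open>G\<close> may overlap. For the
  induction step, apply the hypothesis to the two halves \<open>D \<inter> G\<close> and \<open>D - G\<close> and unite the results;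
  this is why \<open>D\<close> is arbitrary and why \<open>D\<close> itself has to be cut: that is the claim about the new \<open>G\<close>.
\<close>

lemma (in finite_measure) exists_subset_far_from_finite_family:
  assumes small: "\<And>e. e > 0 \<Longrightarrow>
      \<exists>U::nat \<Rightarrow> 'a set. range U \<subseteq> sets M \<and> (\<Union>i. U i) = space M \<and> (\<forall>i. measure M (U i) \<le> e)"
    and "finite \<G>" "\<G> \<subseteq> sets M" "D \<in> sets M"
  shows "\<exists>F\<in>sets M. F \<subseteq> D \<and> measure M D / 3 \<le> measure M F \<and> measure M D / 3 \<le> measure M (D - F) \<and>
    (\<forall>G\<in>\<G>. measure M (D \<inter> G) / 3 \<le> measure M (D \<inter> G - F) \<and> measure M (D - G) / 3 \<le> measure M (F - G))"
  using assms(2-4)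
proof (induction \<G> arbitrary: D rule: finite_induct)
  case empty
  then show ?case using exists_balanced_subset[OF small] by (metis empty_iff)
next
  case (insert G \<G>)
  have meas: "D \<in> sets M" "G \<in> sets M" "\<G> \<subseteq> sets M" "D \<inter> G \<in> sets M" "D - G \<in> sets M"
    using insert.prems by auto
  obtain F1 where F1: "F1 \<in> sets M" "F1 \<subseteq> D \<inter> G" "measure M (D \<inter> G) / 3 \<le> measure M F1"
    "measure M (D \<inter> G) / 3 \<le> measure M (D \<inter> G - F1)"
    "\<And>H. H \<in> \<G> \<Longrightarrow> measure M (D \<inter> G \<inter> H) / 3 \<le> measure M (D \<inter> G \<inter> H - F1)"
    "\<And>H. H \<in> \<G> \<Longrightarrow> measure M (D \<inter> G - H) / 3 \<le> measure M (F1 - H)"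
    using insert.IH[OF meas(3,4)] by auto
  obtain F2 where F2: "F2 \<in> sets M" "F2 \<subseteq> D - G" "measure M (D - G) / 3 \<le> measure M F2"
    "measure M (D - G) / 3 \<le> measure M (D - G - F2)"
    "\<And>H. H \<in> \<G> \<Longrightarrow> measure M ((D - G) \<inter> H) / 3 \<le> measure M ((D - G) \<inter> H - F2)"
    "\<And>H. H \<in> \<G> \<Longrightarrow> measure M (D - G - H) / 3 \<le> measure M (F2 - H)"
    using insert.IH[OF meas(3,5)] by auto
  have split: "measure M A = measure M (A \<inter> G) + measure M (A - G)" if "A \<in> sets M" for A
    using finite_measure_Union[of "A \<inter> G" "A - G"] that meas(2)
    by (simp add: Int_Diff_Un Int_Diff_disjoint)
  let ?F = "F1 \<union> F2"
  have eq: "?F \<inter> G = F1" "?F - G = F2" "(D - ?F) \<inter> G = D \<inter> G - F1" "D - ?F - G = D - G - F2"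
    "D \<inter> G - ?F = D \<inter> G - F1"
    using F1(2) F2(2) by auto
  show ?case
  proof (intro bexI[of _ ?F] conjI ballI)
    show "measure M D / 3 \<le> measure M ?F"
      using split[of D] split[of ?F] F1(1,3) F2(1,3) meas unfolding eq by simp
    show "measure M D / 3 \<le> measure M (D - ?F)"
      using split[of D] split[of "D - ?F"] F1(1,4) F2(1,4) meas unfolding eq by simp
    fix H assume H: "H \<in> insert G \<G>"
    have "measure M (D \<inter> H) / 3 \<le> measure M (D \<inter> H - ?F) \<and> measure M (D - H) / 3 \<le> measure M (?F - H)"
    proof (cases "H = G")
      case True
      then show ?thesis using F1(4) F2(3) by (simp add: eq)
    next
      case False
      with H have HG: "H \<in> \<G>" by simp
      then have Hm: "H \<in> sets M" using meas by auto
      have sets: "(D \<inter> H) \<inter> G = D \<inter> G \<inter> H" "D \<inter> H - G = (D - G) \<inter> H"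
        "(D \<inter> H - ?F) \<inter> G = D \<inter> G \<inter> H - F1" "D \<inter> H - ?F - G = (D - G) \<inter> H - F2"
        "(D - H) \<inter> G = D \<inter> G - H" "D - H - G = D - G - H"
        "(?F - H) \<inter> G = F1 - H" "?F - H - G = F2 - H"
        using F1(2) F2(2) by auto
      show ?thesis
        using split[of "D \<inter> H"] split[of "D \<inter> H - ?F"] split[of "D - H"] split[of "?F - H"]
          F1(1) F1(5,6)[OF HG] F2(1) F2(5,6)[OF HG] meas Hm unfolding sets by simp
    qed
    then show "measure M (D \<inter> H) / 3 \<le> measure M (D \<inter> H - ?F)"
      "measure M (D - H) / 3 \<le> measure M (?F - H)" by auto
  qed (use F1(1,2) F2(1,2) in auto)
qed

section \<open>Norm estimates for indicator functions\<close>

text \<open>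
  As \<open>1 / c \<le> 1\<close> and \<open>p x \<ge> 1\<close>, the integrand of the modular is at most \<open>1 / c\<close> on \<open>E\<close>.
\<close>

lemma (in Lp_exponent) scaled_indicator_unit_ball:
  fixes f :: "'a \<Rightarrow> 'b::{real_normed_field,second_countable_topology}"
  assumes E: "E \<in> sets M" "emeasure M E \<le> ennreal c" and c: "1 \<le> c"
  defines "f \<equiv> (\<lambda>x. of_real (indicator E x / c))"
  shows "f \<in> Lp_fun M p" "Lp_norm M p f \<le> 1"
proof -
  have "norm (f x) powr p x \<le> indicator E x / c" for x
    using powr_mono'[of 1 "p x" "1 / c"] p_ge1[of x] c
    by (auto simp: f_def indicator_def norm_divide)
  then have "modular M p (\<lambda>x. f x /\<^sub>R 1) \<le> (\<integral>\<^sup>+x. ennreal (1 / c) * indicator E x \<partial>M)"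
    unfolding modular_def
    by (intro nn_integral_mono)
      (metis divide_inverse_commute ennreal_indicator ennreal_leI ennreal_mult'' indicator_pos_le
        inverse_1 inverse_eq_divide scaleR_one)
  also have "\<dots> = ennreal (1 / c) * emeasure M E"
    using E by (simp add: nn_integral_cmult_indicator)
  also have "\<dots> \<le> ennreal (1 / c) * ennreal c"
    by (rule mult_left_mono[OF E(2)]) simp
  also have "\<dots> = 1" using c by (simp flip: ennreal_mult)
  finally have le: "modular M p (\<lambda>x. f x /\<^sub>R 1) \<le> 1" .
  then show "Lp_norm M p f \<le> 1" by (intro Lp_norm_le) auto
  have "f \<in> borel_measurable M" unfolding f_def using E by measurable
  then show "f \<in> Lp_fun M p"
    using le_less_trans[OF le, of \<infinity>] by (auto simp: Lp_fun_def intro!: exI[of _ 1])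
qed

text \<open>
  If the norm were less than \<open>a < t * b\<close>, then \<open>t / a \<ge> 1\<close>, so on \<open>B\<close> the integrand of the modular of
  \<open>f / a\<close> would be at least \<open>(t / a) powr p x \<ge> t / a\<close>, and the modular at least \<open>t * b / a > 1\<close>.
  The condition \<open>b \<le> 1\<close> gives \<open>a < t\<close>, so that the power does not decrease the base.
\<close>

lemma (in Lp_exponent) Lp_norm_lower_bound:
  fixes f :: "'a \<Rightarrow> 'b::{real_normed_field,second_countable_topology}"
  assumes f: "f \<in> Lp_fun M p" and B: "B \<in> sets M" "ennreal b \<le> emeasure M B"
    and t: "t > 0" "\<And>x. x \<in> B \<Longrightarrow> t \<le> norm (f x)" and b: "b \<le> 1"
  shows "t * b \<le> Lp_norm M p f"
proof (rule ccontr)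
  assume "\<not> t * b \<le> Lp_norm M p f"
  then have less: "Lp_norm M p f < t * b" by simp
  then obtain a where a: "Lp_norm M p f < a" "a < t * b" using dense by blast
  have a0: "a > 0" and le1: "modular M p (\<lambda>x. f x /\<^sub>R a) \<le> 1"
    using Lp_norm_less[OF f a(1)] by auto
  have "t * b \<le> t * 1" using t b by (intro mult_left_mono) auto
  then have at: "a < t" using a by simp
  have "t / a * indicator B x \<le> norm (f x /\<^sub>R a) powr p x" for x
  proof (cases "x \<in> B")
    case True
    have "t / a \<le> norm (f x /\<^sub>R a)"
      using t(2)[OF True] a0 by (simp add: field_simps)
    moreover have "1 \<le> t / a" using at a0 by simp
    ultimately have "t / a \<le> norm (f x /\<^sub>R a)" "1 \<le> norm (f x /\<^sub>R a)" by linarith+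
    then show ?thesis
      using powr_mono[of 1 "p x" "norm (f x /\<^sub>R a)"] p_ge1[of x] True by auto
  qed simp
  then have "(\<integral>\<^sup>+x. ennreal (t / a) * indicator B x \<partial>M) \<le> modular M p (\<lambda>x. f x /\<^sub>R a)"
    unfolding modular_def
    by (intro nn_integral_mono) (metis ennreal_indicator ennreal_leI ennreal_mult'' indicator_pos_le)
  then have "ennreal (t / a) * emeasure M B \<le> 1"
    using B le1 by (simp add: nn_integral_cmult_indicator)
  moreover have "ennreal (t / a) * ennreal b \<le> ennreal (t / a) * emeasure M B"
    by (rule mult_left_mono[OF B(2)]) simp
  ultimately have "ennreal (t / a) * ennreal b \<le> 1" by (rule order_trans[rotated])
  then have "t / a * b \<le> 1"
    using t a0 by (simp flip: ennreal_mult')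
  then show False using a a0 by (simp add: field_simps)
qed

section \<open>Non-compactness\<close>

theorem theorem3:
  fixes M :: "'a::metric_space measure" and Q :: real
    and p :: "'a \<Rightarrow> real" and \<phi> :: "'a \<Rightarrow> 'a"
    and C\<^sub>\<phi> :: "('a \<Rightarrow> 'b::{real_normed_field, second_countable_topology}) \<Rightarrow> ('a \<Rightarrow> 'b)"
  assumes "metric_measure_space M"
    and "Q > 0" and "ahlfors_regular M Q"
    and "doubling M"
    and "p \<in> variable_exponents"
    and "\<phi> \<in> measurable borel borel" and "nonsingular M \<phi>"
    and "C\<^sub>\<phi> = composition_operator \<phi>"
    and "Lp_bounded_operator M p C\<^sub>\<phi>" and "Lp_nonzero_operator M p C\<^sub>\<phi>"
  shows "\<not> Lp_compact_operator M p C\<^sub>\<phi>"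
proof
  assume compact: "Lp_compact_operator M p C\<^sub>\<phi>"
  interpret metric_measure_space M by fact
  interpret Lp_exponent M p using Lp_exponent assms(5) .
  interpret L: Metric_space "Lp_space M p :: ('a \<Rightarrow> 'b) set set" "Lp_dist M p"
    by (rule Metric_space_Lp)
  note [measurable] = assms(6)
  have space: "space M = UNIV"
    using subsetD[OF borel_sets sets.top[of borel]] sets.sets_into_space[of UNIV M] by auto
  have bs: "A \<in> sets borel \<Longrightarrow> A \<in> sets M" for A using borel_sets by auto
  have phi: "\<phi> -` F \<in> sets borel" if "F \<in> sets borel" for F
    using measurable_sets[OF assms(6) that] by simp

  \<comment> \<open>Only bounded sets are known to have finite measure, so \<open>A0 n\<close> bounds both \<open>x\<close> and \<open>\<phi> x\<close>;
    these sets exhaust the space.\<close>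
  fix x0 :: 'a
  define A0 where "A0 n = ball x0 (real n) \<inter> \<phi> -` ball x0 (real n)" for n
  have A0: "A0 n \<in> sets borel" for n unfolding A0_def by (intro sets.Int phi) auto
  obtain n where n: "emeasure M (A0 n) \<noteq> 0"
  proof (rule ccontr)
    assume "\<not> thesis"
    then have "emeasure M (A0 n) = 0" for n using that by blast
    then have "emeasure M (\<Union>n. A0 n) = 0"
      using A0 bs by (intro emeasure_UN_eq_0) auto
    moreover have "(\<Union>n. A0 n) = UNIV"
    proof -
      have "\<exists>n. x \<in> A0 n" for x
        using reals_Archimedean2[of "max (dist x0 x) (dist x0 (\<phi> x))"] by (auto simp: A0_def)
      then show ?thesis by auto
    qed
    ultimately show False using open_pos[of UNIV] by simp
  qed
  define A E where "A = A0 n" and "E = ball x0 (real n)"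
  have A: "A \<in> sets borel" "A \<in> sets M" "A \<subseteq> \<phi> -` E" "A \<subseteq> E"
    using A0[of n] bs[OF A0[of n]] by (auto simp: A_def A0_def E_def)
  have E: "E \<in> sets borel" "emeasure M E < \<infinity>"
    unfolding E_def using bounded_finite[OF bs] by auto
  have A_fin: "emeasure M A < \<infinity>"
    using emeasure_mono[OF A(4) bs[OF E(1)]] E(2) by simp

  \<comment> \<open>\<open>N\<close> measures how much of \<open>A\<close> a set catches under \<open>\<phi>\<close>. Restricting to \<open>A\<close> keeps it finite:
    the preimage of a bounded set may have infinite measure.\<close>
  define N where "N = distr (density M (indicator A)) borel \<phi>"
  have phiM: "\<phi> \<in> measurable M borel"
    using bs[OF phi] by (auto simp: measurable_def space)
  have N: "sets N = sets borel" "space N = UNIV"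
    by (auto simp: N_def)
  have emN: "emeasure N F = emeasure M (A \<inter> \<phi> -` F)" if F: "F \<in> sets borel" for F
  proof -
    have "emeasure N F = emeasure (density M (indicator A)) (\<phi> -` F)"
      unfolding N_def using phiM F by (subst emeasure_distr) (auto simp: space)
    also have "\<dots> = emeasure M (A \<inter> \<phi> -` F)"
      using A(2) bs[OF phi[OF F]]
      by (subst emeasure_density)
        (auto simp: space indicator_inter_arith[symmetric] simp flip: nn_integral_indicator)
    finally show ?thesis .
  qed
  interpret N: finite_measure N
    by (rule finite_measureI) (use emN[of UNIV] A_fin in \<open>simp add: N\<close>)
  have "measure N {x} = 0" for x
  proof -
    have "emeasure M (\<phi> -` {x}) = 0"
      using assms(7) ahlfors_regular_singleton_null[OF assms(2,3)] by (auto simp: nonsingular_def)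
    then have "emeasure M (A \<inter> \<phi> -` {x}) = 0"
      using emeasure_mono[of "A \<inter> \<phi> -` {x}" "\<phi> -` {x}" M] bs[OF phi] by auto
    then show ?thesis using emN[of "{x}"] by (simp add: measure_def)
  qed
  then have small: "\<exists>U::nat \<Rightarrow> 'a set. range U \<subseteq> sets N \<and> (\<Union>i. U i) = space N \<and> (\<forall>i. measure N (U i) \<le> e)"
    if "e > 0" for e
    using small_countable_cover[OF N.finite_measure_axioms N(1) _ that] N(2) by metis

  define c where "c = max 1 (measure M E)"
  have c: "1 \<le> c" "emeasure M E \<le> ennreal c"
    using E(2) by (auto simp: c_def emeasure_eq_ennreal_measure intro!: ennreal_leI)
  define f :: "'a set \<Rightarrow> 'a \<Rightarrow> 'b" where "f F = (\<lambda>x. of_real (indicator (F \<inter> E) x / c))" for F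
  have f: "f F \<in> Lp_fun M p" "Lp_norm M p (f F) \<le> 1" if "F \<in> sets borel" for F
    unfolding f_def
    using scaled_indicator_unit_ball[of "F \<inter> E" c]
      order_trans[OF emeasure_mono c(2), of "F \<inter> E"] bs[OF sets.Int[OF that E(1)]] bs[OF E(1)] c(1)
    by auto
  have T: "C\<^sub>\<phi> (f F) \<in> Lp_fun M p" if "F \<in> sets borel" for F
    using assms(9) f(1)[OF that] unfolding Lp_bounded_operator_def by blast
  define m where "m = measure N UNIV"
  have m: "m > 0"
    using n emN[of UNIV] A_fin by (auto simp: m_def measure_def A_def enn2real_positive_iff zero_less_iff_neq_zero)
  \<comment> \<open>the lower bound of the norm when the difference is \<open>1 / c\<close> on a set of measure \<open>m / 3\<close>\<close>
  define d where "d = 1 / c * min 1 (m / 3)"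
  have d: "d > 0" using m c by (simp add: d_def)

  \<comment> \<open>Total boundedness passes to subsets with the net inside the subset, so the centres of the net
    can be taken to be images of indicator functions.\<close>
  let ?S = "{Lp_class M p (C\<^sub>\<phi> f) |f. f \<in> Lp_fun M p \<and> Lp_norm M p f \<le> 1}"
  let ?I = "(\<lambda>F. Lp_class M p (C\<^sub>\<phi> (f F))) ` sets borel"
  have "?S \<subseteq> Lp_space M p"
    using assms(9) by (auto simp: Lp_bounded_operator_def intro!: Lp_class_in_space)
  then have "?S \<subseteq> L.mtopology closure_of ?S"
    by (intro closure_of_subset) simp
  moreover have "?I \<subseteq> ?S" using f by blast
  ultimately have sub: "?I \<subseteq> L.mtopology closure_of ?S" by (rule order_trans[rotated])
  have "L.mtotally_bounded (L.mtopology closure_of ?S)"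
    using compact unfolding Lp_compact_operator_def by (intro L.compactin_imp_mtotally_bounded) auto
  then have "L.mtotally_bounded ?I"
    by (rule L.mtotally_bounded_subset[OF _ sub])
  then have "\<exists>K. finite K \<and> K \<subseteq> ?I \<and> ?I \<subseteq> (\<Union>F\<in>K. L.mball F d)"
    unfolding L.mtotally_bounded_def using d by simp
  then obtain K where K: "finite K" "K \<subseteq> ?I" "?I \<subseteq> (\<Union>F\<in>K. L.mball F d)"
    by (elim exE conjE)
  obtain \<G> where G: "finite \<G>" "\<G> \<subseteq> sets borel" "K = (\<lambda>F. Lp_class M p (C\<^sub>\<phi> (f F))) ` \<G>"
    using finite_subset_image[OF K(1,2)] by blast
  obtain F where F: "F \<in> sets borel"
    and far: "\<And>G. G \<in> \<G> \<Longrightarrow> measure N G / 3 \<le> measure N (G - F)"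
      "\<And>G. G \<in> \<G> \<Longrightarrow> measure N (UNIV - G) / 3 \<le> measure N (F - G)"
    using N.exists_subset_far_from_finite_family[OF small G(1), of UNIV] G(2) N by auto
  obtain G where GG: "G \<in> \<G>" and
    dist: "Lp_dist M p (Lp_class M p (C\<^sub>\<phi> (f G))) (Lp_class M p (C\<^sub>\<phi> (f F))) < d"
  proof -
    have "Lp_class M p (C\<^sub>\<phi> (f F)) \<in> (\<Union>F\<in>K. L.mball F d)" using K(3) F by blast
    then show ?thesis using that unfolding G(3) by auto
  qed
  have Gb: "G \<in> sets borel" using GG G(2) by auto
  define B where "B = A \<inter> \<phi> -` ((G - F) \<union> (F - G))"
  have B: "B \<in> sets M"
    unfolding B_def using A(2) F Gb by (intro sets.Int bs[OF phi]) auto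
  \<comment> \<open>In \<open>N\<close>-measure, \<open>G - F\<close> has at least a third of \<open>G\<close> and \<open>F - G\<close> at least a third of its complement.\<close>
  have "m / 3 \<le> measure N ((G - F) \<union> (F - G))"
  proof -
    have "m = measure N G + measure N (UNIV - G)"
      unfolding m_def using N.finite_measure_compl[of G] Gb N by simp
    moreover have "measure N ((G - F) \<union> (F - G)) = measure N (G - F) + measure N (F - G)"
      using Gb F N by (intro N.finite_measure_Union) auto
    ultimately show ?thesis using far[OF GG] by simp
  qed
  then have "ennreal (m / 3) \<le> emeasure N ((G - F) \<union> (F - G))"
    by (simp add: N.emeasure_eq_measure ennreal_leI)
  then have mB: "ennreal (min 1 (m / 3)) \<le> emeasure M B"
    unfolding B_def using emN[of "(G - F) \<union> (F - G)"] Gb F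
    by (intro order_trans[OF ennreal_leI[of "min 1 (m / 3)" "m / 3"]]) auto
  have "d \<le> Lp_norm M p (\<lambda>x. C\<^sub>\<phi> (f G) x - C\<^sub>\<phi> (f F) x)"
    unfolding d_def
  proof (rule Lp_norm_lower_bound[OF Lp_fun_diff[OF T[OF Gb] T[OF F]] B mB])
    fix x assume "x \<in> B"
    then have "\<phi> x \<in> E" "\<phi> x \<in> (G - F) \<union> (F - G)" using A(3) by (auto simp: B_def)
    then have "norm (C\<^sub>\<phi> (f G) x - C\<^sub>\<phi> (f F) x) = 1 / c"
      using c(1) by (auto simp: norm_divide assms(8) composition_operator_def f_def)
    then show "1 / c \<le> norm (C\<^sub>\<phi> (f G) x - C\<^sub>\<phi> (f F) x)" by simp
  qed (use c in auto)
  also have "\<dots> = Lp_dist M p (Lp_class M p (C\<^sub>\<phi> (f G))) (Lp_class M p (C\<^sub>\<phi> (f F)))"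
    by (rule Lp_dist_class[symmetric, OF T[OF Gb] T[OF F]])
  finally show False using dist by simp
qed

end
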